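(* Let $(a_n)_{n\ge1}$ be a strictly increasing sequence of positive integers and $A_N=\{a_n: n\le N\}$. Suppose there is a constant $c>0$ such that $E(A_N)\ge cN^3$ for infinitely many $N$. Then the set $\mathrm{NPPC}((a_n)_n)$ has full Lebesgue measure in $(0,1)$.
   Context: For a finite set of integers $I$, the additive energy is $E(I)=\#\{(a,b,c,d)\in I^4: a+b=c+d\}$. Let $\|x\|$ denote the distance from $x\in\mathbb{R}$ to the nearest integer. For $\alpha\in\mathbb{R}$, $s\ge0$, $N\ge1$ define the pair correlation function $R([-s,s],\alpha,N)=\frac1N\#\{1\le i\ne j\le N: \|\alpha a_i-\alpha a_j\|\le s/N\}$. The sequence $(\langle\alpha a_n\rangle)_n$ of fractional parts has Poissonian pair correlations (PPC) if $R([-s,s],\alpha,N)\to 2s$ as $N\to\infty$ for every $s\ge0$. $\mathrm{NPPC}((a_n)_n)$ is the set of $\alpha\in(0,1)$ for which there exists some $s\ge0$ such that $R([-s,s],\alpha,N)$ does not tend to $2s$ as $N\to\infty$. *)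

theory Defs
  imports "HOL-Analysis.Analysis"
begin

definition additive_energy :: "int set \<Rightarrow> nat" where
  "additive_energy I =
     card {(a, b, c, d). a \<in> I \<and> b \<in> I \<and> c \<in> I \<and> d \<in> I \<and> a + b = c + d}"

definition dist_nearest_int :: "real \<Rightarrow> real" where
  "dist_nearest_int x = infdist x \<int>"

text \<open>Sequences are indexed from 1: the value \<open>a 0\<close> is never used.\<close>

definition pair_correlation :: "(nat \<Rightarrow> int) \<Rightarrow> real \<Rightarrow> real \<Rightarrow> nat \<Rightarrow> real" where
  "pair_correlation a s \<alpha> N =
     real (card {(i, j). i \<in> {1..N} \<and> j \<in> {1..N} \<and> i \<noteq> j \<and>
       dist_nearest_int (\<alpha> * of_int (a i) - \<alpha> * of_int (a j)) \<le> s / real N}) / real N"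

definition NPPC :: "(nat \<Rightarrow> int) \<Rightarrow> real set" where
  "NPPC a = {\<alpha> \<in> {0<..<1}.
     \<exists>s\<ge>0. \<not> (\<lambda>N. pair_correlation a s \<alpha> N) \<longlonglongrightarrow> 2 * s}"

end

theory Submission
  imports Defs
begin

text \<open>
  Every \<open>\<alpha>\<close> fails to have Poissonian pair correlations, so that NPPC is all of \<open>(0,1)\<close>.
  Let \<open>r(f)\<close> be the number of representations of \<open>f\<close> as a difference of elements of \<open>A\<^sub>N\<close>, and cut
  the circle into \<open>M \<approx> N/K\<close> arcs of length at most \<open>K/N\<close>. Writing an additive quadruple as an equality
  of differences \<open>a - d = c - b\<close> and splitting according to the arc that contains \<open>\<alpha> a\<close>,
  Cauchy--Schwarz bounds \<open>E(A\<^sub>N)\<close> by \<open>M\<close> times the number of quadruples in which \<open>\<alpha> a\<close> and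
  \<open>\<alpha> c\<close> share an arc. Regrouping these as \<open>a - c = d - b\<close>, that number is at most the sum of
  \<open>r(x - y)\<close> over the pairs \<open>(x, y)\<close> with a common arc. Under Poissonian pair correlations at scale
  \<open>K\<close> there are only about \<open>2 K N\<close> off-diagonal pairs of this kind, so \<open>E(A\<^sub>N) \<ge> c N\<^sup>3\<close> with
  \<open>K\<close> large forces a nonzero \<open>f\<close> with \<open>r(f) \<ge> c N / 12\<close> and \<open>\<parallel>\<alpha> f\<parallel> \<le> K/N\<close>. At the point
  \<open>s = N \<parallel>\<alpha> f\<parallel> \<in> [0, K]\<close> the pair correlation function jumps by at least \<open>c / 12\<close>. For
  large \<open>N\<close> it is, however, uniformly close to \<open>2 s\<close> on a finite grid in \<open>[0, K]\<close>.
\<close>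

section \<open>Close pairs and representations of differences\<close>

definition close_pairs :: "real \<Rightarrow> int set \<Rightarrow> real \<Rightarrow> (int \<times> int) set" where
  "close_pairs \<alpha> A t =
     {(x, y) \<in> A \<times> A. x \<noteq> y \<and> dist_nearest_int (\<alpha> * of_int x - \<alpha> * of_int y) \<le> t}"

definition diff_reps :: "int set \<Rightarrow> int \<Rightarrow> (int \<times> int) set" where
  "diff_reps A f = {(x, y) \<in> A \<times> A. x - y = f}"

lemma finite_close_pairs: "finite A \<Longrightarrow> finite (close_pairs \<alpha> A t)"
  unfolding close_pairs_def by (rule finite_subset[of _ "A \<times> A"]) auto

lemma finite_diff_reps: "finite A \<Longrightarrow> finite (diff_reps A f)"
  unfolding diff_reps_def by (rule finite_subset[of _ "A \<times> A"]) auto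

lemma card_diff_reps_0: "card (diff_reps A 0) = card A"
proof -
  have "diff_reps A 0 = (\<lambda>x. (x, x)) ` A"
    by (auto simp: diff_reps_def)
  then show ?thesis
    by (simp add: card_image inj_on_def)
qed

text \<open>Injectivity of \<open>a\<close> lets pairs of indices be replaced by pairs of values,
  among which representations of a difference can be counted.\<close>

lemma pair_correlation_eq_card_close_pairs:
  assumes "inj_on a {1..N}"
  shows "pair_correlation a s \<alpha> N = real (card (close_pairs \<alpha> (a ` {1..N}) (s / real N))) / real N"
proof -
  let ?I = "{(i, j). i \<in> {1..N} \<and> j \<in> {1..N} \<and> i \<noteq> j \<and>
       dist_nearest_int (\<alpha> * of_int (a i) - \<alpha> * of_int (a j)) \<le> s / real N}"
  have "inj_on (map_prod a a) ?I"
    by (rule inj_on_subset[OF map_prod_inj_on[OF assms assms]]) auto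
  moreover have "map_prod a a ` ?I = close_pairs \<alpha> (a ` {1..N}) (s / real N)"
    by (auto simp: close_pairs_def dest: inj_onD[OF assms])
  ultimately have "card ?I = card (close_pairs \<alpha> (a ` {1..N}) (s / real N))"
    using card_image by fastforce
  then show ?thesis
    by (simp add: pair_correlation_def)
qed

section \<open>Cauchy-Schwarz on fibres and the energy bound\<close>

lemma card_fibre_product_eq_sum_squares:
  assumes "finite S" "finite T" "h ` S \<subseteq> T"
  shows "card {(u, v) \<in> S \<times> S. h u = h v} = (\<Sum>y\<in>T. (card {u \<in> S. h u = y})\<^sup>2)"
proof -
  have "{(u, v) \<in> S \<times> S. h u = h v} = (\<Union>y\<in>T. {u \<in> S. h u = y} \<times> {u \<in> S. h u = y})"
    using assms(3) by auto
  also have "card \<dots> = (\<Sum>y\<in>T. card ({u \<in> S. h u = y} \<times> {u \<in> S. h u = y}))"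
    using assms by (intro card_UN_disjoint) auto
  finally show ?thesis
    by (simp add: card_cartesian_product power2_eq_square)
qed

text \<open>Each fibre of \<open>g\<close> splits by \<open>p\<close> into at most
  \<open>card P\<close> cells; Cauchy-Schwarz bounds its squared size by \<open>card P\<close> times
  the sum of the squared cell sizes.\<close>

lemma card_fibre_product_le_refinement:
  fixes g :: "'a \<Rightarrow> 'b" and p :: "'a \<Rightarrow> 'c"
  assumes "finite S" "finite P" "p ` S \<subseteq> P"
  shows "card {(u, v) \<in> S \<times> S. g u = g v}
       \<le> card P * card {(u, v) \<in> S \<times> S. g u = g v \<and> p u = p v}"
proof -
  define n where "n y k = card {u \<in> S. g u = y \<and> p u = k}" for y k
  have split: "card {u \<in> S. g u = y} = (\<Sum>k\<in>P. n y k)" for y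
  proof -
    have "{u \<in> S. g u = y} = (\<Union>k\<in>P. {u \<in> S. g u = y \<and> p u = k})"
      using assms(3) by auto
    also have "card \<dots> = (\<Sum>k\<in>P. n y k)"
      unfolding n_def using assms by (intro card_UN_disjoint) auto
    finally show ?thesis .
  qed
  have cs: "(\<Sum>k\<in>P. n y k)\<^sup>2 \<le> card P * (\<Sum>k\<in>P. (n y k)\<^sup>2)" for y
  proof -
    have "(\<Sum>k\<in>P. real (n y k))\<^sup>2 \<le> (\<Sum>k\<in>P. (real (n y k))\<^sup>2) * card P"
      by (rule sum_squared_le_sum_of_squares)
    then have "real ((\<Sum>k\<in>P. n y k)\<^sup>2) \<le> real (card P * (\<Sum>k\<in>P. (n y k)\<^sup>2))"
      by (simp add: mult.commute)
    then show ?thesis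
      by (simp only: of_nat_le_iff)
  qed
  have "card {(u, v) \<in> S \<times> S. g u = g v} = (\<Sum>y\<in>g ` S. (\<Sum>k\<in>P. n y k)\<^sup>2)"
    using card_fibre_product_eq_sum_squares[of S "g ` S" g] assms(1) by (simp add: split)
  also have "\<dots> \<le> (\<Sum>y\<in>g ` S. card P * (\<Sum>k\<in>P. (n y k)\<^sup>2))"
    by (intro sum_mono cs)
  also have "\<dots> = card P * (\<Sum>(y, k)\<in>g ` S \<times> P. (n y k)\<^sup>2)"
    by (simp add: sum_distrib_left sum.cartesian_product split_def)
  also have "(\<Sum>(y, k)\<in>g ` S \<times> P. (n y k)\<^sup>2) = card {(u, v) \<in> S \<times> S. (g u, p u) = (g v, p v)}"
    using assms
    by (subst card_fibre_product_eq_sum_squares[of S "g ` S \<times> P" "\<lambda>u. (g u, p u)"])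
       (auto simp: n_def intro!: sum.cong)
  finally show ?thesis
    by simp
qed

text \<open>If \<open>x - y = x' - y'\<close>, then also \<open>x - x' = y - y'\<close>, so asking
  that \<open>x\<close> and \<open>x'\<close> share a class constrains only the pair
  \<open>w = (x, x')\<close>.\<close>

lemma additive_energy_le_class_quadruples:
  fixes p :: "int \<Rightarrow> 'c"
  assumes "finite A" "finite P" "p ` A \<subseteq> P"
  shows "additive_energy A
       \<le> card P * card {(w, z) \<in> (A \<times> A) \<times> (A \<times> A). p (fst w) = p (snd w) \<and> fst w - snd w = fst z - snd z}"
proof -
  let ?S = "A \<times> A"
  let ?g = "\<lambda>(x, y). x - y :: int"
  \<comment> \<open>The sum equation \<open>x + y' = x' + y\<close> is the equality
    \<open>x - y = x' - y'\<close> rearranged.\<close>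
  have "bij_betw (\<lambda>((x, y), (x', y')). (x, y', x', y)) {(u, v) \<in> ?S \<times> ?S. ?g u = ?g v}
      {(a, b, c, d). a \<in> A \<and> b \<in> A \<and> c \<in> A \<and> d \<in> A \<and> a + b = c + d}"
    by (rule bij_betw_byWitness[where f' = "\<lambda>(x, y', x', y). ((x, y), (x', y'))"]) auto
  then have "additive_energy A = card {(u, v) \<in> ?S \<times> ?S. ?g u = ?g v}"
    unfolding additive_energy_def by (rule bij_betw_same_card[symmetric])
  also have "\<dots> \<le> card P * card {(u, v) \<in> ?S \<times> ?S. ?g u = ?g v \<and> p (fst u) = p (fst v)}"
    using assms by (intro card_fibre_product_le_refinement) auto
  also have "card {(u, v) \<in> ?S \<times> ?S. ?g u = ?g v \<and> p (fst u) = p (fst v)}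
      = card {(w, z) \<in> ?S \<times> ?S. p (fst w) = p (snd w) \<and> fst w - snd w = fst z - snd z}"
    by (rule bij_betw_same_card[of "\<lambda>((x, y), (x', y')). ((x, x'), (y, y'))"],
        rule bij_betw_byWitness[where f' = "\<lambda>((x, x'), (y, y')). ((x, y), (x', y'))"]) auto
  finally show ?thesis .
qed

text \<open>Over a fixed \<open>w\<close> the choices of \<open>z\<close> are the representations of
  its difference; diagonal pairs have \<open>card A\<close> of them each. \<open>Q\<close> may
  exceed the pairs sharing a class, so that close pairs can take its place.\<close>

lemma additive_energy_le_of_diff_reps_le:
  fixes p :: "int \<Rightarrow> 'c"
  assumes "finite A" "finite P" "p ` A \<subseteq> P"
    and Q: "finite Q" "\<And>x y. x \<in> A \<Longrightarrow> y \<in> A \<Longrightarrow> x \<noteq> y \<Longrightarrow> p x = p y \<Longrightarrow> (x, y) \<in> Q"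
    and m: "\<And>x y. (x, y) \<in> Q \<Longrightarrow> card (diff_reps A (x - y)) \<le> m"
  shows "additive_energy A \<le> card P * ((card A)\<^sup>2 + card Q * m)"
proof -
  let ?D = "(\<lambda>x. (x, x)) ` A"
  have "{(w, z) \<in> (A \<times> A) \<times> (A \<times> A). p (fst w) = p (snd w) \<and> fst w - snd w = fst z - snd z}
      \<subseteq> Sigma (?D \<union> Q) (\<lambda>w. diff_reps A (fst w - snd w))"
    using Q(2) by (fastforce simp: diff_reps_def)
  moreover have fin: "finite (Sigma (?D \<union> Q) (\<lambda>w. diff_reps A (fst w - snd w)))"
    using assms finite_diff_reps by (intro finite_SigmaI) auto
  ultimately have "card {(w, z) \<in> (A \<times> A) \<times> (A \<times> A). p (fst w) = p (snd w) \<and> fst w - snd w = fst z - snd z}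
      \<le> card (Sigma (?D \<union> Q) (\<lambda>w. diff_reps A (fst w - snd w)))"
    by (rule card_mono[rotated])
  also have "\<dots> = (\<Sum>w\<in>?D \<union> Q. card (diff_reps A (fst w - snd w)))"
    using assms finite_diff_reps by (intro card_SigmaI) auto
  also have "\<dots> \<le> (\<Sum>w\<in>?D. card (diff_reps A (fst w - snd w)))
      + (\<Sum>w\<in>Q. card (diff_reps A (fst w - snd w)))"
    using assms by (simp add: sum_Un_nat)
  also have "(\<Sum>w\<in>?D. card (diff_reps A (fst w - snd w))) = (card A)\<^sup>2"
    by (simp add: sum.reindex inj_on_def card_diff_reps_0 power2_eq_square)
  also have "(\<Sum>w\<in>Q. card (diff_reps A (fst w - snd w))) \<le> card Q * m"
    using m sum_bounded_above[of Q "\<lambda>w. card (diff_reps A (fst w - snd w))" m] by auto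
  finally show ?thesis
    using additive_energy_le_class_quadruples[OF assms(1-3)]
    by (meson add_left_mono le_trans mult_le_mono2)
qed

section \<open>Arcs of the circle and a popular close difference\<close>

lemma dist_nearest_int_le_same_arc:
  fixes u v :: real and M :: nat
  assumes "M > 0" "\<lfloor>real M * frac u\<rfloor> = \<lfloor>real M * frac v\<rfloor>"
  shows "dist_nearest_int (u - v) \<le> 1 / real M"
proof -
  have "\<bar>real M * frac u - real M * frac v\<bar> \<le> 1"
    using assms(2) by linarith
  then have "real M * \<bar>frac u - frac v\<bar> \<le> 1"
    by (simp add: abs_mult flip: right_diff_distrib)
  then have "\<bar>frac u - frac v\<bar> \<le> 1 / real M"
    using assms(1) by (simp add: field_simps)
  \<comment> \<open>Passing to fractional parts changes \<open>u - v\<close> by exactly this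
    integer.\<close>
  moreover have "dist (u - v) (of_int (\<lfloor>u\<rfloor> - \<lfloor>v\<rfloor>)) = \<bar>frac u - frac v\<bar>"
    by (simp add: dist_real_def frac_def algebra_simps)
  moreover have "infdist (u - v) \<int> \<le> dist (u - v) (of_int (\<lfloor>u\<rfloor> - \<lfloor>v\<rfloor>))"
    by (rule infdist_le) auto
  ultimately show ?thesis
    unfolding dist_nearest_int_def by linarith
qed

lemma additive_energy_le_of_diff_reps_close_pairs_le:
  assumes "finite A" "M > 0" "1 / real M \<le> t"
    and "\<And>x y. (x, y) \<in> close_pairs \<alpha> A t \<Longrightarrow> card (diff_reps A (x - y)) \<le> m"
  shows "additive_energy A \<le> M * ((card A)\<^sup>2 + card (close_pairs \<alpha> A t) * m)"
proof -
  define p where "p x = \<lfloor>real M * frac (\<alpha> * of_int x)\<rfloor>" for x :: int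
  have "p ` A \<subseteq> {0..<int M}"
  proof (rule image_subsetI)
    fix x
    have "real M * frac (\<alpha> * of_int x) < real M * 1"
      using assms(2) frac_lt_1 by (intro mult_strict_left_mono) auto
    then show "p x \<in> {0..<int M}"
      by (simp add: p_def floor_less_iff)
  qed
  moreover have "(x, y) \<in> close_pairs \<alpha> A t"
    if "x \<in> A" "y \<in> A" "x \<noteq> y" "p x = p y" for x y
    using that dist_nearest_int_le_same_arc[OF assms(2), of "\<alpha> * of_int x" "\<alpha> * of_int y"] assms(3)
    by (auto simp: close_pairs_def p_def)
  ultimately show ?thesis
    using additive_energy_le_of_diff_reps_le[of A "{0..<int M}" p "close_pairs \<alpha> A t" m]
      assms(1,4) finite_close_pairs by auto
qed

text \<open>Otherwise diagonal and off-diagonal pairs each contribute at most \<open>c / 2\<close>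
  times \<open>real N ^ 3\<close>: the first since \<open>K \<ge> 4 / c\<close>, the second since
  \<open>2 / K * (3 * K) * (c / 12) = c / 2\<close>.\<close>

lemma ex_popular_close_difference:
  assumes "finite A" "card A = N" "c > 0" "K \<ge> 1" "K \<ge> 4 / c" "real N \<ge> K"
    and E: "real (additive_energy A) \<ge> c * real N ^ 3"
    and pc: "real (card (close_pairs \<alpha> A (K / real N))) \<le> 3 * K * real N"
  obtains x y where "(x, y) \<in> close_pairs \<alpha> A (K / real N)"
    "real (card (diff_reps A (x - y))) \<ge> c / 12 * real N"
proof (rule ccontr)
  note obtained = that
  assume no: "\<not> thesis"
  have less: "real (card (diff_reps A (x - y))) < c / 12 * real N"
    if xy: "(x, y) \<in> close_pairs \<alpha> A (K / real N)" for x y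
    using xy no by (meson obtained not_le)
  \<comment> \<open>Rounding up keeps the arcs no longer than \<open>K / real N\<close>;
    \<open>real N \<ge> K\<close> keeps \<open>M\<close> strictly below
    \<open>2 * (real N / K)\<close>, which makes the final bound strict.\<close>
  define M where "M = nat \<lceil>real N / K\<rceil>"
  define m where "m = nat \<lfloor>c / 12 * real N\<rfloor>"
  have N: "real N > 0"
    using assms by linarith
  have NK: "real N / K \<ge> 1"
    using assms by simp
  have M: "real M \<ge> real N / K" "real M < 2 * (real N / K)" "M > 0"
    using NK unfolding M_def by linarith+
  have m: "real m \<le> c / 12 * real N"
    using of_int_floor_le[of "c / 12 * real N"] assms(3) by (simp only: m_def) simp
  have "card (diff_reps A (x - y)) \<le> m" if "(x, y) \<in> close_pairs \<alpha> A (K / real N)" for x y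
    using less[OF that] unfolding m_def by linarith
  moreover have "1 / real M \<le> K / real N"
    using M N assms(4) by (simp add: field_simps)
  ultimately have "additive_energy A \<le> M * ((card A)\<^sup>2 + card (close_pairs \<alpha> A (K / real N)) * m)"
    using assms(1) M(3) by (intro additive_energy_le_of_diff_reps_close_pairs_le)
  then have "real (additive_energy A)
      \<le> real M * ((real N)\<^sup>2 + real (card (close_pairs \<alpha> A (K / real N))) * real m)"
    using assms(2) by (metis of_nat_add of_nat_le_iff of_nat_mult of_nat_power)
  also have "\<dots> \<le> real M * ((real N)\<^sup>2 + (3 * K * real N) * (c / 12 * real N))"
    using pc m assms(4) by (intro mult_left_mono add_left_mono mult_mono) auto
  also have "\<dots> < 2 * (real N / K) * ((real N)\<^sup>2 + (3 * K * real N) * (c / 12 * real N))"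
    using M(2) N assms(3,4) by (intro mult_strict_right_mono add_pos_nonneg) auto
  also have "\<dots> = (2 / K + c / 2) * real N ^ 3"
    using assms(4) by (simp add: field_simps power2_eq_square power3_eq_cube)
  also have "\<dots> \<le> c * real N ^ 3"
    using assms(3,4,5) by (intro mult_right_mono) (auto simp: field_simps)
  finally show False
    using E by linarith
qed

section \<open>The jump of the pair correlation function\<close>

lemma dist_nearest_int_nonneg: "dist_nearest_int x \<ge> 0"
  by (simp add: dist_nearest_int_def infdist_nonneg)

lemma dist_nearest_int_diff_reps:
  assumes "(x', y') \<in> diff_reps A (x - y)"
  shows "dist_nearest_int (\<alpha> * of_int x' - \<alpha> * of_int y')
       = dist_nearest_int (\<alpha> * of_int x - \<alpha> * of_int y)"
proof -
  have "x' - y' = x - y"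
    using assms by (simp add: diff_reps_def)
  then show ?thesis
    by (metis of_int_diff right_diff_distrib)
qed

lemma diff_reps_subset_close_pairs:
  assumes "x \<noteq> y" "dist_nearest_int (\<alpha> * of_int x - \<alpha> * of_int y) \<le> t"
  shows "diff_reps A (x - y) \<subseteq> close_pairs \<alpha> A t"
proof (rule subrelI)
  fix x' y'
  assume *: "(x', y') \<in> diff_reps A (x - y)"
  show "(x', y') \<in> close_pairs \<alpha> A t"
    using * assms(1) assms(2)[folded dist_nearest_int_diff_reps[OF *]]
    by (auto simp: diff_reps_def close_pairs_def)
qed

text \<open>All representations of \<open>x - y\<close> have the same distance, so they enter the
  close pairs together.\<close>

lemma close_pairs_jump:
  assumes "finite A" "x \<noteq> y" "t < dist_nearest_int (\<alpha> * of_int x - \<alpha> * of_int y)"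
    "dist_nearest_int (\<alpha> * of_int x - \<alpha> * of_int y) \<le> t'"
  shows "card (close_pairs \<alpha> A t) + card (diff_reps A (x - y)) \<le> card (close_pairs \<alpha> A t')"
proof -
  have "(x', y') \<notin> close_pairs \<alpha> A t" if "(x', y') \<in> diff_reps A (x - y)" for x' y'
    using assms(3)[folded dist_nearest_int_diff_reps[OF that]] by (simp add: close_pairs_def)
  then have "diff_reps A (x - y) \<inter> close_pairs \<alpha> A t = {}"
    by auto
  then have "card (close_pairs \<alpha> A t) + card (diff_reps A (x - y))
      = card (close_pairs \<alpha> A t \<union> diff_reps A (x - y))"
    using assms(1) finite_close_pairs finite_diff_reps by (subst card_Un_disjoint) auto
  also have "\<dots> \<le> card (close_pairs \<alpha> A t')"
    using diff_reps_subset_close_pairs[OF assms(2,4), of A] assms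
    by (intro card_mono finite_close_pairs) (auto simp: close_pairs_def)
  finally show ?thesis .
qed

lemma not_poissonian:
  fixes a :: "nat \<Rightarrow> int"
  assumes "strict_mono_on {1..} a" "c > 0"
    and inf: "infinite {N. N \<ge> 1 \<and> real (additive_energy (a ` {1..N})) \<ge> c * real N ^ 3}"
  shows "\<exists>s\<ge>0. \<not> (\<lambda>N. pair_correlation a s \<alpha> N) \<longlonglongrightarrow> 2 * s"
proof (rule ccontr)
  assume "\<not> ?thesis"
  then have lim: "(\<lambda>N. pair_correlation a s \<alpha> N) \<longlonglongrightarrow> 2 * s" if "s \<ge> 0" for s
    using that by blast
  have inj: "inj_on a {1..N}" for N
    using strict_mono_on_imp_inj_on[OF assms(1)] by (rule inj_on_subset) auto
  define K where "K = max 1 (4 / c)"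
  \<comment> \<open>The jump \<open>c / 12\<close> is \<open>5 * \<delta>\<close>, but one grid step
    allows less than \<open>4 * \<delta>\<close>: \<open>2 * \<delta>\<close> from the slope and
    less than \<open>\<delta>\<close> of error at each end.\<close>
  define \<delta> where "\<delta> = c / 60"
  define L where "L = nat \<lceil>K / \<delta>\<rceil>"
  have \<delta>: "\<delta> > 0"
    using assms(2) by (simp add: \<delta>_def)
  have "\<forall>\<^sub>F N in sequentially. pair_correlation a K \<alpha> N < 3 * K"
    using lim[of K] by (rule order_tendstoD) (auto simp: K_def)
  moreover have "\<forall>\<^sub>F N in sequentially. \<forall>j\<in>{..L}.
      \<bar>pair_correlation a (real j * \<delta>) \<alpha> N - 2 * (real j * \<delta>)\<bar> < \<delta>"
    using lim \<delta> by (intro eventually_ball_finite) (auto simp: tendsto_iff dist_real_def)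
  moreover have "\<forall>\<^sub>F N in sequentially. real N \<ge> K"
    using filterlim_real_sequentially by (simp add: filterlim_at_top)
  ultimately have "\<forall>\<^sub>F N in sequentially. pair_correlation a K \<alpha> N < 3 * K \<and> real N \<ge> K \<and>
      (\<forall>j\<in>{..L}. \<bar>pair_correlation a (real j * \<delta>) \<alpha> N - 2 * (real j * \<delta>)\<bar> < \<delta>)"
    by eventually_elim auto
  then obtain N\<^sub>0 where N\<^sub>0: "\<And>N. N \<ge> N\<^sub>0 \<Longrightarrow> pair_correlation a K \<alpha> N < 3 * K \<and> real N \<ge> K \<and>
      (\<forall>j\<in>{..L}. \<bar>pair_correlation a (real j * \<delta>) \<alpha> N - 2 * (real j * \<delta>)\<bar> < \<delta>)"
    unfolding eventually_sequentially by blast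
  obtain N where N: "N \<ge> N\<^sub>0" "N \<ge> 1" "real (additive_energy (a ` {1..N})) \<ge> c * real N ^ 3"
    using inf unfolding infinite_nat_iff_unbounded_le by blast
  define A where "A = a ` {1..N}"
  have A: "finite A" "card A = N"
    using inj by (simp_all add: A_def card_image)
  have pc: "pair_correlation a s \<alpha> N = real (card (close_pairs \<alpha> A (s / real N))) / real N" for s
    unfolding A_def by (rule pair_correlation_eq_card_close_pairs[OF inj])
  have "real (card (close_pairs \<alpha> A (K / real N))) \<le> 3 * K * real N"
    using N\<^sub>0[OF N(1)] N(2) by (simp add: pc field_simps)
  then obtain x y where xy: "(x, y) \<in> close_pairs \<alpha> A (K / real N)"
    "real (card (diff_reps A (x - y))) \<ge> c / 12 * real N"
    using ex_popular_close_difference[of A N c K \<alpha>] A assms(2) N N\<^sub>0[OF N(1)]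
    by (auto simp: A_def K_def)
  define d where "d = dist_nearest_int (\<alpha> * of_int x - \<alpha> * of_int y)"
  have d: "d \<ge> 0" "d \<le> K / real N" "x \<noteq> y"
    using xy(1) by (auto simp: d_def close_pairs_def dist_nearest_int_nonneg)
  have grid: "\<bar>pair_correlation a (real j * \<delta>) \<alpha> N - 2 * (real j * \<delta>)\<bar> < \<delta>" if "j \<le> L" for j
    using N\<^sub>0[OF N(1)] that by blast
  \<comment> \<open>The first grid point \<open>j * \<delta>\<close> at or above the rescaled
    distance \<open>d * real N\<close>.\<close>
  define j where "j = nat \<lceil>d * real N / \<delta>\<rceil>"
  have dN: "d * real N \<ge> 0" "d * real N \<le> K"
    using d N(2) by (auto simp: field_simps)
  have "d * real N / \<delta> \<le> K / \<delta>"
    using dN(2) \<delta> by (intro divide_right_mono) auto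
  then have jL: "j \<le> L"
    unfolding j_def L_def by (intro nat_mono ceiling_mono)
  have "d * real N / \<delta> \<le> real j"
    unfolding j_def by linarith
  then have upper: "d \<le> real j * \<delta> / real N"
    using \<delta> N(2) by (simp add: field_simps)
  show False
  proof (cases j)
    \<comment> \<open>Here \<open>d = 0\<close> and no grid point lies below the jump, but the pairs
      at distance 0 alone push the correlation at \<open>s = 0\<close> up to
      \<open>5 * \<delta>\<close>, against its bound \<open>\<delta>\<close>.\<close>
    case 0
    then have "card (diff_reps A (x - y)) \<le> card (close_pairs \<alpha> A (0 / real N))"
      using diff_reps_subset_close_pairs[OF d(3), of \<alpha> 0 A] upper A(1)
      by (intro card_mono finite_close_pairs) (auto simp: d_def)
    with xy(2) have "c / 12 * real N \<le> real (card (close_pairs \<alpha> A (0 / real N)))"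
      by linarith
    then have "c / 12 \<le> pair_correlation a 0 \<alpha> N"
      using N(2) by (simp add: pc field_simps)
    with grid[of 0] show False
      using assms(2) by (simp add: \<delta>_def)
  next
    case (Suc i)
    have "real i < d * real N / \<delta>"
      using Suc unfolding j_def by linarith
    then have lower: "real i * \<delta> / real N < d"
      using \<delta> N(2) by (simp add: field_simps)
    have "card (close_pairs \<alpha> A (real i * \<delta> / real N)) + card (diff_reps A (x - y))
        \<le> card (close_pairs \<alpha> A (real j * \<delta> / real N))"
      using close_pairs_jump[OF A(1) d(3)] lower upper by (simp add: d_def)
    then have "real (card (close_pairs \<alpha> A (real i * \<delta> / real N))) + c / 12 * real N
        \<le> real (card (close_pairs \<alpha> A (real j * \<delta> / real N)))"
      using xy(2) by linarith
    from divide_right_mono[OF this, of "real N"]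
    have "pair_correlation a (real i * \<delta>) \<alpha> N + c / 12 \<le> pair_correlation a (real j * \<delta>) \<alpha> N"
      using N(2) by (simp add: pc add_divide_distrib)
    moreover have "real j * \<delta> = real i * \<delta> + \<delta>"
      using Suc by (simp add: algebra_simps)
    ultimately have "c / 12 < 4 * \<delta>"
      using grid[of i] grid[of j] jL Suc by auto
    then show False
      using assms(2) by (simp add: \<delta>_def)
  qed
qed

theorem theorem1:
  fixes a :: "nat \<Rightarrow> int" and c :: real
  assumes "strict_mono_on {1..} a"
    and "\<And>n. n \<ge> 1 \<Longrightarrow> a n > 0"
    and "c > 0"
    and "infinite {N. N \<ge> 1 \<and> real (additive_energy (a ` {1..N})) \<ge> c * real N ^ 3}"
  shows "NPPC a \<in> sets lebesgue \<and> emeasure lebesgue (NPPC a) = emeasure lebesgue {0<..<1::real}"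
proof -
  have "NPPC a = {0<..<1}"
    using not_poissonian[OF assms(1,3,4)] by (auto simp: NPPC_def)
  then show ?thesis
    by simp
qed

end
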